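(* Consider the single-machine scheduling problem with uniform linear deterioration and release times, with the makespan objective. The Earliest Completion Time First (ECTF) algorithm achieves an approximation ratio $\rho$ with $\rho\in\left[2,\,3+\frac{1}{\beta}\right]$; in particular, on every instance with deterioration rate $\beta>0$, the makespan $T$ of the ECTF schedule satisfies $T\le\left(3+\frac{1}{\beta}\right)T^*$, where $T^*$ is the optimal makespan.
   Context: Problem: a single machine must process a set $\mathcal{J}=\{1,\ldots,n\}$ of jobs non-preemptively, at most one job at a time. Job $i$ has a release time $r_i\ge 0$ and a fixed processing time $\alpha_i\ge 0$, and there is a common deterioration rate $\beta>0$. If job $i$ starts at time $s_i\ge r_i$, its processing time is $p_i(s_i)=\alpha_i+\beta s_i$, so it completes at $C_i=(1+\beta)s_i+\alpha_i$. A schedule is feasible if jobs do not overlap and $s_i\ge r_i$ for all $i$. The makespan is $T=\max_i C_i$; $T^*$ denotes the minimum makespan over feasible schedules. An algorithm is $\rho$-approximate if it always returns a feasible schedule of makespan at most $\rho T^*$. ECTF algorithm: for a time $t$ and a job $i$, let $\Gamma_i(t)=(1+\beta)\max\{t,r_i\}+\alpha_i$ (the completion time of $i$ if it is the next job started from time $t$ onward). Starting at $t=0$, each time $t$ the machine becomes available, ECTF picks among the jobs not yet scheduled a job $i$ minimizing $\Gamma_i(t)$ and starts it at time $\max\{t,r_i\}$. *)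

theory Defs
  imports Complex_Main
begin

record sched_instance =
  num_jobs :: nat
  release :: "nat \<Rightarrow> real"
  fixed_time :: "nat \<Rightarrow> real"
  det_rate :: real

definition jobs :: "sched_instance \<Rightarrow> nat set" where
  "jobs I = {1..num_jobs I}"

text \<open>At least one job is required, since the makespan is a maximum over all jobs.\<close>

definition valid_instance :: "sched_instance \<Rightarrow> bool" where
  "valid_instance I \<longleftrightarrow>
     1 \<le> num_jobs I \<and> 0 < det_rate I \<and>
     (\<forall>i\<in>jobs I. 0 \<le> release I i \<and> 0 \<le> fixed_time I i)"

definition processing_time :: "sched_instance \<Rightarrow> nat \<Rightarrow> real \<Rightarrow> real" where
  "processing_time I i t = fixed_time I i + det_rate I * t"

text \<open>A schedule is given by its start times; values outside \<^term>\<open>jobs I\<close> are irrelevant.\<close>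

type_synonym schedule = "nat \<Rightarrow> real"

definition completion :: "sched_instance \<Rightarrow> schedule \<Rightarrow> nat \<Rightarrow> real" where
  "completion I s i = s i + processing_time I i (s i)"

definition feasible :: "sched_instance \<Rightarrow> schedule \<Rightarrow> bool" where
  "feasible I s \<longleftrightarrow>
     (\<forall>i\<in>jobs I. release I i \<le> s i) \<and>
     (\<forall>i\<in>jobs I. \<forall>j\<in>jobs I. i \<noteq> j \<longrightarrow> completion I s i \<le> s j \<or> completion I s j \<le> s i)"

definition makespan :: "sched_instance \<Rightarrow> schedule \<Rightarrow> real" where
  "makespan I s = Max (completion I s ` jobs I)"

text \<open>The infimum is a minimum: for each of the finitely many job orders, starting
  every job as early as possible is optimal.\<close>

definition opt_makespan :: "sched_instance \<Rightarrow> real" where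
  "opt_makespan I = Inf (makespan I ` {s. feasible I s})"

definition next_completion :: "sched_instance \<Rightarrow> nat \<Rightarrow> real \<Rightarrow> real" where
  "next_completion I i t = (1 + det_rate I) * max t (release I i) + fixed_time I i"

text \<open>\<open>ectf_run I t U s\<close>: with the machine available at time \<open>t\<close> and \<open>U\<close> the set of jobs
  not yet scheduled, \<open>s\<close> gives start times on \<open>U\<close> that some run of the greedy rule produces.
  Ties may be broken in any way.\<close>

inductive ectf_run :: "sched_instance \<Rightarrow> real \<Rightarrow> nat set \<Rightarrow> schedule \<Rightarrow> bool"
  for I :: sched_instance where
  finished: "ectf_run I t {} s"
| start: "\<lbrakk>i \<in> U; \<forall>j\<in>U. next_completion I i t \<le> next_completion I j t;
           s i = max t (release I i); ectf_run I (next_completion I i t) (U - {i}) s\<rbrakk>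
          \<Longrightarrow> ectf_run I t U s"

definition ectf_schedule :: "sched_instance \<Rightarrow> schedule \<Rightarrow> bool" where
  "ectf_schedule I s \<longleftrightarrow> ectf_run I 0 (jobs I) s"

text \<open>An algorithm maps instances to schedules; one ECTF algorithm for each way of breaking ties.\<close>

definition ectf_algorithm :: "(sched_instance \<Rightarrow> schedule) \<Rightarrow> bool" where
  "ectf_algorithm A \<longleftrightarrow> (\<forall>I. valid_instance I \<longrightarrow> ectf_schedule I (A I))"

definition approximates ::
  "(sched_instance \<Rightarrow> schedule) \<Rightarrow> sched_instance set \<Rightarrow> real \<Rightarrow> bool" where
  "approximates A \<I> \<rho> \<longleftrightarrow>
     (\<forall>I\<in>\<I>. feasible I (A I) \<and> makespan I (A I) \<le> \<rho> * opt_makespan I)"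

lemma ectf_run_cong:
  assumes "ectf_run I t U s" "\<And>i. i \<in> U \<Longrightarrow> s i = s' i"
  shows "ectf_run I t U s'"
  using assms
proof (induction rule: ectf_run.induct)
  case (finished t s)
  show ?case by (rule ectf_run.finished)
next
  case (start i U t s)
  have "ectf_run I (next_completion I i t) (U - {i}) s'"
    by (rule start.IH) (use start.prems in blast)
  moreover have "s' i = max t (release I i)"
    using start.hyps(1,3) start.prems by metis
  ultimately show ?case
    using start.hyps(1,2) by (blast intro: ectf_run.start)
qed

lemma ectf_run_exists:
  assumes "finite U"
  shows "\<exists>s. ectf_run I t U s"
  using assms
proof (induction "card U" arbitrary: U t)
  case 0
  then have "U = {}" by simp
  then show ?case using ectf_run.finished by blast
next
  case (Suc n)
  then have "U \<noteq> {}" by auto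
  define i where "i = arg_min_on (\<lambda>i. next_completion I i t) U"
  have iU: "i \<in> U"
    unfolding i_def by (rule arg_min_if_finite(1)[OF Suc.prems \<open>U \<noteq> {}\<close>])
  have imin: "\<forall>j\<in>U. next_completion I i t \<le> next_completion I j t"
    unfolding i_def by (rule ballI) (rule arg_min_least[OF Suc.prems \<open>U \<noteq> {}\<close>])
  have "n = card (U - {i})" "finite (U - {i})"
    using Suc.hyps(2) Suc.prems iU by simp_all
  then obtain s where s: "ectf_run I (next_completion I i t) (U - {i}) s"
    using Suc.hyps(1) by blast
  have "ectf_run I (next_completion I i t) (U - {i}) (s(i := max t (release I i)))"
    by (rule ectf_run_cong[OF s]) simp
  moreover have "(s(i := max t (release I i))) i = max t (release I i)"
    by simp
  ultimately have "ectf_run I t U (s(i := max t (release I i)))"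
    using ectf_run.start[OF iU imin] by blast
  then show ?case by blast
qed

lemma ectf_algorithm_exists: "\<exists>A. ectf_algorithm A"
proof -
  have "\<forall>I. \<exists>s. ectf_schedule I s"
    by (simp add: ectf_schedule_def jobs_def ectf_run_exists)
  then show ?thesis
    unfolding ectf_algorithm_def using choice[of ectf_schedule] by blast
qed

end

theory Submission
  imports Defs
begin

text \<open>Write \<open>g = 1 + \<beta>\<close> and let \<open>M\<close> be the makespan of any feasible schedule. A job \<open>i\<close> followed
  by \<open>e i\<close> jobs in that schedule contributes \<open>g ^ e i * \<alpha>\<^sub>i\<close> to \<open>M\<close>, and \<open>g ^ e i * \<Gamma>\<^sub>i(0) \<le> M\<close>.
  When ECTF becomes available at time \<open>t\<close> with a set \<open>U\<close> of \<open>k + 1\<close> jobs left, the job \<open>i\<close> of \<open>U\<close>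
  that comes first in the given schedule has \<open>e i \<ge> k\<close>. The next completion time \<open>t'\<close> of ECTF is at
  most \<open>\<Gamma>\<^sub>i(t) = max (g * t + \<alpha>\<^sub>i) (\<Gamma>\<^sub>i(0))\<close>, hence either \<open>g ^ k * t' \<le> M\<close> or \<open>g ^ k * t'\<close>
  exceeds \<open>g ^ (k + 1) * t\<close> by at most \<open>g ^ k * \<alpha>\<^sub>i\<close>. A job \<open>i\<close> is charged at most once for each
  \<open>k \<le> e i\<close>, so by the geometric series all charges add up to at most \<open>(g / \<beta>) * M\<close>, and ECTF
  ends by \<open>(1 + g / \<beta>) * M = (2 + 1 / \<beta>) * M\<close>.

  For the lower bound, let ECTF wait for a job with \<open>\<alpha> = 0\<close> that is released just early enough
  to complete before a job that is available at time \<open>0\<close>, and let \<open>\<beta>\<close> tend to \<open>0\<close>.\<close>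

section \<open>Completion times\<close>

lemma completion_eq: "completion I s i = (1 + det_rate I) * s i + fixed_time I i"
  by (simp add: completion_def processing_time_def algebra_simps)

lemma next_completion_eq_max:
  assumes "0 < det_rate I"
  shows "next_completion I i t =
    max ((1 + det_rate I) * t) ((1 + det_rate I) * release I i) + fixed_time I i"
  using assms by (simp add: next_completion_def max_mult_distrib_left)

lemma le_next_completion:
  assumes "0 < det_rate I" "0 \<le> t" "0 \<le> fixed_time I i"
  shows "t \<le> next_completion I i t"
proof -
  have "t \<le> max t (release I i)" by simp
  also have "\<dots> \<le> (1 + det_rate I) * max t (release I i)"
    using assms by (simp add: algebra_simps)
  finally show ?thesis using assms(3) by (simp add: next_completion_def)
qed

lemma le_completion:
  assumes "0 < det_rate I" "0 \<le> s i" "0 \<le> fixed_time I i"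
  shows "s i \<le> completion I s i"
  using assms by (simp add: completion_def processing_time_def)

section \<open>Feasibility of ECTF schedules\<close>

lemma ectf_run_ge_start:
  assumes "ectf_run I t U s" "0 < det_rate I" "0 \<le> t" "\<forall>i\<in>U. 0 \<le> fixed_time I i" "i \<in> U"
  shows "t \<le> s i \<and> release I i \<le> s i"
  using assms
proof (induction arbitrary: i rule: ectf_run.induct)
  case (finished t s)
  then show ?case by simp
next
  case (start i0 U t s)
  have t': "t \<le> next_completion I i0 t"
    using start.prems start.hyps(1) by (intro le_next_completion) auto
  show ?case
  proof (cases "i = i0")
    case True
    then show ?thesis using start.hyps(3) by simp
  next
    case False
    have "next_completion I i0 t \<le> s i \<and> release I i \<le> s i"
      by (rule start.IH) (use start.prems False t' in auto)
    then show ?thesis using t' by simp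
  qed
qed

text \<open>The job started first completes exactly when the machine becomes available again, and no
  remaining job starts before that time.\<close>

lemma ectf_run_no_overlap:
  assumes "ectf_run I t U s" "0 < det_rate I" "0 \<le> t" "\<forall>i\<in>U. 0 \<le> fixed_time I i"
    "i \<in> U" "j \<in> U" "i \<noteq> j"
  shows "completion I s i \<le> s j \<or> completion I s j \<le> s i"
  using assms
proof (induction arbitrary: i j rule: ectf_run.induct)
  case (finished t s)
  then show ?case by simp
next
  case (start i0 U t s)
  have t': "0 \<le> next_completion I i0 t"
    using le_next_completion[of I t i0] start.prems start.hyps(1) by auto
  have first: "completion I s i0 \<le> s k" if "k \<in> U" "k \<noteq> i0" for k
    using ectf_run_ge_start[OF start.hyps(4) start.prems(1) t', of k] start.prems(3) that
    by (simp add: completion_eq start.hyps(3) next_completion_def)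
  show ?case
  proof (cases "i = i0 \<or> j = i0")
    case True
    then show ?thesis using first start.prems by blast
  next
    case False
    show ?thesis
      by (rule start.IH) (use start.prems False t' in auto)
  qed
qed

lemma ectf_schedule_feasible:
  assumes "valid_instance I" "ectf_schedule I s"
  shows "feasible I s"
  using assms ectf_run_ge_start[of I 0 "jobs I" s] ectf_run_no_overlap[of I 0 "jobs I" s]
  unfolding feasible_def valid_instance_def ectf_schedule_def by simp

section \<open>Positions of the jobs in a feasible schedule\<close>

text \<open>Minimizing the completion time rather than the start time settles ties: a job of zero
  length at time \<open>0\<close> may share its start time with a longer job and must precede
  it.\<close>

lemma ex_first_job:
  assumes "finite U" "U \<noteq> {}" "0 < det_rate I"
    "\<forall>i\<in>U. 0 \<le> s i \<and> 0 \<le> fixed_time I i"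
    "\<forall>i\<in>U. \<forall>j\<in>U. i \<noteq> j \<longrightarrow> completion I s i \<le> s j \<or> completion I s j \<le> s i"
  shows "\<exists>i\<in>U. \<forall>j\<in>U - {i}. completion I s i \<le> s j"
proof -
  define i where "i = arg_min_on (completion I s) U"
  have iU: "i \<in> U"
    unfolding i_def by (rule arg_min_if_finite(1)[OF assms(1,2)])
  have imin: "completion I s i \<le> completion I s j" if "j \<in> U" for j
    unfolding i_def by (rule arg_min_least[OF assms(1,2) that])
  have "completion I s i \<le> s j" if j: "j \<in> U" "j \<noteq> i" for j
  proof (rule ccontr)
    assume neg: "\<not> completion I s i \<le> s j"
    then have "completion I s j \<le> s i" using assms(5) iU j by blast
    with imin[OF j(1)] have "completion I s i \<le> s i" by simp
    moreover have nonneg: "0 \<le> s i" "0 \<le> fixed_time I i" "0 \<le> s j"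
      using assms(4) iU j(1) by blast+
    ultimately have "det_rate I * s i \<le> 0"
      by (simp add: completion_def processing_time_def)
    with assms(3) nonneg have "s i = 0" by (simp add: mult_le_0_iff)
    with \<open>completion I s i \<le> s i\<close> neg nonneg show False by simp
  qed
  with iU show ?thesis by blast
qed

text \<open>\<open>e i\<close> is the number of jobs of \<open>U\<close> that come after \<open>i\<close> in the schedule. Ties between jobs of
  zero length starting at time \<open>0\<close> make it awkward to define it from the start times.\<close>

lemma feasible_positions:
  assumes "finite U" "0 < det_rate I" "0 \<le> b" "b \<le> M"
    "\<forall>i\<in>U. b \<le> s i \<and> release I i \<le> s i \<and> 0 \<le> fixed_time I i \<and> completion I s i \<le> M"
    "\<forall>i\<in>U. \<forall>j\<in>U. i \<noteq> j \<longrightarrow> completion I s i \<le> s j \<or> completion I s j \<le> s i"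
  shows "\<exists>e :: nat \<Rightarrow> nat.
     (1 + det_rate I) ^ card U * b + (\<Sum>i\<in>U. (1 + det_rate I) ^ e i * fixed_time I i) \<le> M \<and>
     (\<forall>i\<in>U. (1 + det_rate I) ^ e i * next_completion I i 0 \<le> M) \<and>
     (\<forall>V\<subseteq>U. V \<noteq> {} \<longrightarrow> (\<exists>i\<in>V. card V \<le> Suc (e i)))"
  using assms
proof (induction "card U" arbitrary: U b)
  case 0
  then show ?case by simp
next
  case (Suc n)
  define g where "g = 1 + det_rate I"
  have g: "1 < g" using Suc.prems by (simp add: g_def)
  have "\<exists>i\<in>U. \<forall>j\<in>U - {i}. completion I s i \<le> s j"
  proof (rule ex_first_job[OF Suc.prems(1) _ Suc.prems(2) _ Suc.prems(6)])
    show "U \<noteq> {}" using Suc.hyps(2) by auto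
    show "\<forall>i\<in>U. 0 \<le> s i \<and> 0 \<le> fixed_time I i"
      using Suc.prems(3,5) order_trans by blast
  qed
  then obtain i where i: "i \<in> U" "\<forall>j\<in>U - {i}. completion I s i \<le> s j"
    by blast
  have si: "b \<le> s i" "release I i \<le> s i" "0 \<le> fixed_time I i" "completion I s i \<le> M" "0 \<le> s i"
    using Suc.prems(3,5) i(1) order_trans by blast+
  have ci: "0 \<le> completion I s i"
    using le_completion[of I s i] si Suc.prems(2) by simp
  have card: "n = card (U - {i})" using Suc.hyps(2) Suc.prems(1) i(1) by simp
  \<comment> \<open>The first job \<open>i\<close> is removed; its completion time replaces
    \<open>b\<close> as the lower bound on the remaining start times.\<close>
  have "\<exists>e :: nat \<Rightarrow> nat.
     (1 + det_rate I) ^ card (U - {i}) * completion I s i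
       + (\<Sum>j\<in>U - {i}. (1 + det_rate I) ^ e j * fixed_time I j) \<le> M \<and>
     (\<forall>j\<in>U - {i}. (1 + det_rate I) ^ e j * next_completion I j 0 \<le> M) \<and>
     (\<forall>V\<subseteq>U - {i}. V \<noteq> {} \<longrightarrow> (\<exists>j\<in>V. card V \<le> Suc (e j)))"
    using Suc.prems(1,5,6) si(4) i(2) by (intro Suc.hyps(1)[OF card _ Suc.prems(2) ci]) auto
  then obtain e where e:
    "g ^ n * completion I s i + (\<Sum>j\<in>U - {i}. g ^ e j * fixed_time I j) \<le> M"
    "\<forall>j\<in>U - {i}. g ^ e j * next_completion I j 0 \<le> M"
    "\<forall>V\<subseteq>U - {i}. V \<noteq> {} \<longrightarrow> (\<exists>j\<in>V. card V \<le> Suc (e j))"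
    unfolding g_def card[symmetric] by blast
  \<comment> \<open>All \<open>n\<close> other jobs of \<open>U\<close> come after
    \<open>i\<close>.\<close>
  define e' where "e' = e(i := n)"
  have others: "(\<Sum>j\<in>U - {i}. g ^ e' j * fixed_time I j) = (\<Sum>j\<in>U - {i}. g ^ e j * fixed_time I j)"
    by (rule sum.cong) (auto simp: e'_def)
  have "g ^ card U * b \<le> g ^ card U * s i"
    using g si by simp
  then have "g ^ card U * b + g ^ n * fixed_time I i \<le> g ^ n * completion I s i"
    by (simp add: Suc.hyps(2)[symmetric] completion_eq g_def algebra_simps)
  then have "g ^ card U * b + (\<Sum>j\<in>U. g ^ e' j * fixed_time I j) \<le> M"
    using e(1) others by (simp add: sum.remove[OF Suc.prems(1) i(1)]) (simp add: e'_def)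
  moreover have "g ^ e' j * next_completion I j 0 \<le> M" if "j \<in> U" for j
  proof (cases "j = i")
    case True
    have "next_completion I i 0 \<le> completion I s i"
      using si g by (simp add: next_completion_def completion_eq g_def)
    then have "g ^ n * next_completion I i 0 \<le> g ^ n * completion I s i"
      using g by simp
    also have "\<dots> \<le> M"
    proof -
      have "0 \<le> (\<Sum>j\<in>U - {i}. g ^ e j * fixed_time I j)"
        using Suc.prems g by (intro sum_nonneg) auto
      then show ?thesis using e(1) by simp
    qed
    finally show ?thesis by (simp add: True e'_def)
  next
    case False
    then show ?thesis using e(2) that by (simp add: e'_def)
  qed
  moreover have "\<exists>j\<in>V. card V \<le> Suc (e' j)" if V: "V \<subseteq> U" "V \<noteq> {}" for V
  proof (cases "i \<in> V")
    case True
    have "card V \<le> Suc n" using card_mono[OF Suc.prems(1) V(1)] Suc.hyps(2) by simp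
    then show ?thesis using True by (auto simp: e'_def)
  next
    case False
    then obtain j where "j \<in> V" "card V \<le> Suc (e j)" using e(3) V by blast
    then show ?thesis using False by (auto simp: e'_def)
  qed
  ultimately show ?case unfolding g_def by blast
qed

section \<open>The charging argument\<close>

text \<open>The bound is a potential that no ECTF step increases. Its sum holds the charges still
  available: job \<open>j\<close> can pay \<open>g ^ k * fixed_time I j\<close> for each
  \<open>k \<le> e j\<close> below the number of jobs left.\<close>

lemma ectf_run_completion_le:
  assumes "ectf_run I t U s" "finite J" "U \<subseteq> J" "0 < det_rate I" "0 \<le> t"
    "\<forall>i\<in>J. 0 \<le> fixed_time I i"
    "\<forall>i\<in>J. (1 + det_rate I) ^ e i * next_completion I i 0 \<le> M"
    "\<forall>V\<subseteq>J. V \<noteq> {} \<longrightarrow> (\<exists>i\<in>V. card V \<le> Suc (e i))"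
    "i \<in> U"
  shows "completion I s i \<le> max ((1 + det_rate I) ^ card U * t) M
     + (\<Sum>j\<in>J. fixed_time I j * (\<Sum>k<min (card U) (Suc (e j)). (1 + det_rate I) ^ k))"
  using assms
proof (induction arbitrary: i rule: ectf_run.induct)
  case (finished t s)
  then show ?case by simp
next
  case (start i0 U t s)
  define g where "g = 1 + det_rate I"
  define W where "W n j = (\<Sum>k<min n (Suc (e j)). g ^ k)" for n j
  define S where "S n = (\<Sum>j\<in>J. fixed_time I j * W n j)" for n
  define t' where "t' = next_completion I i0 t"
  define n where "n = card (U - {i0})"
  have g: "1 < g" using start.prems(3) by (simp add: g_def)
  have finU: "finite U" using start.prems(1,2) finite_subset by blast
  have cardU: "card U = Suc n"
    using card_Suc_Diff1[OF finU start.hyps(1)] by (simp add: n_def)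
  have t': "0 \<le> t'"
    using le_next_completion[of I t i0] start.prems(2-5) start.hyps(1) by (auto simp: t'_def)
  obtain j where j: "j \<in> U" "card U \<le> Suc (e j)"
    using start.prems(2,7) start.hyps(1) by blast
  then have ej: "n \<le> e j" "j \<in> J" using cardU start.prems(2) by auto
  have aj: "0 \<le> fixed_time I j" using ej start.prems(5) by blast
  \<comment> \<open>As \<open>n \<le> e j\<close>, the charge of \<open>j\<close> with exponent
    \<open>n\<close> is still available; this step spends it.\<close>
  have Wj: "W (Suc n) j = W n j + g ^ n"
    using ej by (simp add: W_def min_def)
  have W_mono: "W n k \<le> W (Suc n) k" for k
    unfolding W_def using g by (intro sum_mono2) auto
  have "S (Suc n) - S n = (\<Sum>k\<in>J. fixed_time I k * (W (Suc n) k - W n k))"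
    by (simp add: S_def sum_subtractf right_diff_distrib)
  also have "\<dots> \<ge> fixed_time I j * (W (Suc n) j - W n j)"
    using start.prems(1,5) W_mono ej by (intro member_le_sum) auto
  finally have S: "S n + g ^ n * fixed_time I j \<le> S (Suc n)"
    by (simp add: Wj algebra_simps)
  have "0 \<le> W n k" for k unfolding W_def using g by (intro sum_nonneg) simp
  then have S_nonneg: "0 \<le> S n"
    unfolding S_def using start.prems(5) by (intro sum_nonneg) simp
  have "g ^ n * next_completion I j 0 \<le> M"
  proof (cases "0 \<le> next_completion I j 0")
    case True
    have "g ^ n \<le> g ^ e j" using ej g by simp
    then have "g ^ n * next_completion I j 0 \<le> g ^ e j * next_completion I j 0"
      using True by (rule mult_right_mono)
    also have "\<dots> \<le> M" using start.prems(6) ej by (simp add: g_def)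
    finally show ?thesis .
  next
    case False
    then show ?thesis
      using le_next_completion[of I 0 j] start.prems(3) aj by simp
  qed
  \<comment> \<open>By the greedy choice, \<open>t'\<close> is at most the completion time of
    \<open>j\<close> if started next, either at \<open>t\<close> or at its release time. The second
    case is absorbed by \<open>M\<close>.\<close>
  moreover have "t' \<le> max (g * t + fixed_time I j) (next_completion I j 0)"
  proof -
    have "t' \<le> next_completion I j t" using start.hyps(2) j by (simp add: t'_def)
    then show ?thesis
      using start.prems(3) by (simp add: next_completion_eq_max g_def max_def split: if_splits)
  qed
  then have "g ^ n * t' \<le> g ^ n * max (g * t + fixed_time I j) (next_completion I j 0)"
    using g by simp
  moreover have "g ^ n * max (g * t + fixed_time I j) (next_completion I j 0) =
      max (g ^ Suc n * t + g ^ n * fixed_time I j) (g ^ n * next_completion I j 0)"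
    using g by (simp add: max_mult_distrib_left algebra_simps)
  moreover have "0 \<le> g ^ n * fixed_time I j"
    using g aj by simp
  ultimately have step: "max (g ^ n * t') M + S n \<le> max (g ^ Suc n * t) M + S (Suc n)"
    using S by linarith
  \<comment> \<open>The job just started completes at \<open>t'\<close>; later jobs are covered by
    the induction hypothesis.\<close>
  have "completion I s i \<le> max (g ^ n * t') M + S n"
  proof (cases "i = i0")
    case True
    have "completion I s i = t'"
      by (simp add: True completion_eq start.hyps(3) t'_def next_completion_def)
    also have "t' \<le> g ^ n * t'"
      using g t' by (simp add: mult_le_cancel_right1 one_le_power)
    finally show ?thesis using S_nonneg by simp
  next
    case False
    with start.prems(2,8) have "i \<in> U - {i0}" "U - {i0} \<subseteq> J" by auto
    from start.IH[OF start.prems(1) this(2) start.prems(3) t'[unfolded t'_def] start.prems(5-7) this(1)]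
    show ?thesis by (simp add: g_def t'_def n_def S_def W_def)
  qed
  with step show ?case by (simp add: cardU g_def S_def W_def)
qed

section \<open>From completion times to the optimal makespan\<close>

lemma completion_le_makespan:
  assumes "i \<in> jobs I"
  shows "completion I s i \<le> makespan I s"
  unfolding makespan_def using assms by (intro Max_ge) (auto simp: jobs_def)

lemma makespan_le:
  assumes "valid_instance I" "\<And>i. i \<in> jobs I \<Longrightarrow> completion I s i \<le> x"
  shows "makespan I s \<le> x"
  unfolding makespan_def using assms by (subst Max_le_iff) (auto simp: jobs_def valid_instance_def)

lemma feasible_completion_nonneg:
  assumes "valid_instance I" "feasible I s" "i \<in> jobs I"
  shows "0 \<le> s i" "0 \<le> completion I s i"
proof -
  show "0 \<le> s i"
    using assms unfolding valid_instance_def feasible_def by force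
  then show "0 \<le> completion I s i"
    using assms by (simp add: completion_eq valid_instance_def)
qed

lemma makespan_nonneg:
  assumes "valid_instance I" "feasible I s"
  shows "0 \<le> makespan I s"
proof -
  have "1 \<in> jobs I" using assms(1) by (simp add: jobs_def valid_instance_def)
  then show ?thesis
    using feasible_completion_nonneg(2)[OF assms] completion_le_makespan order_trans by blast
qed

text \<open>Bounds all charges to one job by a multiple of its contribution to the makespan of the
  given schedule.\<close>

lemma geometric_sum_le:
  fixes b :: real
  assumes "0 < b"
  shows "(\<Sum>k<Suc m. (1 + b) ^ k) \<le> (1 + 1 / b) * (1 + b) ^ m"
proof -
  have "(\<Sum>k<Suc m. (1 + b) ^ k) = ((1 + b) ^ Suc m - 1) / b"
    using assms by (subst geometric_sum) auto
  also have "\<dots> \<le> (1 + b) ^ Suc m / b"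
    using assms by (intro divide_right_mono) auto
  also have "\<dots> = (1 + 1 / b) * (1 + b) ^ m"
    using assms by (simp add: field_simps)
  finally show ?thesis .
qed

lemma ectf_makespan_le_feasible:
  assumes "valid_instance I" "ectf_schedule I s" "feasible I s'"
  shows "makespan I s \<le> (2 + 1 / det_rate I) * makespan I s'"
proof (rule makespan_le[OF assms(1)])
  fix i assume i: "i \<in> jobs I"
  define J where "J = jobs I"
  define M where "M = makespan I s'"
  define b where "b = det_rate I"
  have b: "0 < b" using assms(1) by (simp add: b_def valid_instance_def)
  have a: "\<forall>i\<in>J. 0 \<le> fixed_time I i" using assms(1) by (simp add: J_def valid_instance_def)
  have fin: "finite J" by (simp add: J_def jobs_def)
  have M: "0 \<le> M" using makespan_nonneg assms by (simp add: M_def)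
  have "\<exists>e :: nat \<Rightarrow> nat.
     (1 + det_rate I) ^ card J * 0 + (\<Sum>i\<in>J. (1 + det_rate I) ^ e i * fixed_time I i) \<le> M \<and>
     (\<forall>i\<in>J. (1 + det_rate I) ^ e i * next_completion I i 0 \<le> M) \<and>
     (\<forall>V\<subseteq>J. V \<noteq> {} \<longrightarrow> (\<exists>i\<in>V. card V \<le> Suc (e i)))"
    using assms(3) a b M fin feasible_completion_nonneg(1)[OF assms(1,3)]
    by (intro feasible_positions[where s = s'])
       (auto simp: b_def feasible_def J_def M_def completion_le_makespan)
  then obtain e where e:
    "(\<Sum>i\<in>J. (1 + b) ^ e i * fixed_time I i) \<le> M"
    "\<forall>i\<in>J. (1 + b) ^ e i * next_completion I i 0 \<le> M"
    "\<forall>V\<subseteq>J. V \<noteq> {} \<longrightarrow> (\<exists>i\<in>V. card V \<le> Suc (e i))"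
    by (auto simp: b_def)
  have "completion I s i \<le> max ((1 + b) ^ card J * 0) M
     + (\<Sum>j\<in>J. fixed_time I j * (\<Sum>k<min (card J) (Suc (e j)). (1 + b) ^ k))"
    unfolding b_def
    by (rule ectf_run_completion_le) (use assms(2) fin a b e i in \<open>auto simp: b_def J_def ectf_schedule_def\<close>)
  also have "\<dots> \<le> M + (\<Sum>j\<in>J. fixed_time I j * ((1 + 1 / b) * (1 + b) ^ e j))"
  proof (intro add_mono sum_mono mult_left_mono)
    fix j
    have "(\<Sum>k<min (card J) (Suc (e j)). (1 + b) ^ k) \<le> (\<Sum>k<Suc (e j). (1 + b) ^ k)"
      using b by (intro sum_mono2) auto
    also have "\<dots> \<le> (1 + 1 / b) * (1 + b) ^ e j"
      by (rule geometric_sum_le[OF b])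
    finally show "(\<Sum>k<min (card J) (Suc (e j)). (1 + b) ^ k) \<le> (1 + 1 / b) * (1 + b) ^ e j" .
  qed (use M a in auto)
  also have "\<dots> = M + (1 + 1 / b) * (\<Sum>j\<in>J. (1 + b) ^ e j * fixed_time I j)"
    by (simp add: sum_distrib_left mult_ac)
  also have "\<dots> \<le> M + (1 + 1 / b) * M"
    using e(1) b by (intro add_left_mono mult_left_mono) auto
  also have "\<dots> = (2 + 1 / b) * M"
    by (simp add: algebra_simps)
  finally show "completion I s i \<le> (2 + 1 / det_rate I) * makespan I s'"
    by (simp add: b_def M_def)
qed

lemma opt_makespan_le:
  assumes "valid_instance I" "feasible I s"
  shows "opt_makespan I \<le> makespan I s"
  unfolding opt_makespan_def
  by (rule cInf_lower) (use assms makespan_nonneg in \<open>auto intro!: bdd_belowI[of _ 0]\<close>)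

lemma le_opt_makespan:
  assumes "feasible I s" "\<And>s'. feasible I s' \<Longrightarrow> x \<le> makespan I s'"
  shows "x \<le> opt_makespan I"
  unfolding opt_makespan_def by (rule cInf_greatest) (use assms in auto)

lemma ectf_makespan_le_opt:
  assumes "valid_instance I" "ectf_schedule I s"
  shows "makespan I s \<le> (2 + 1 / det_rate I) * opt_makespan I"
proof -
  have "0 < 2 + 1 / det_rate I"
    using assms(1) by (simp add: valid_instance_def add_pos_pos)
  \<comment> \<open>Dividing by the factor gives a lower bound common to all feasible makespans,
    which passes to the infimum.\<close>
  moreover have "makespan I s / (2 + 1 / det_rate I) \<le> opt_makespan I"
    using ectf_schedule_feasible[OF assms] ectf_makespan_le_feasible[OF assms] calculation
    by (intro le_opt_makespan) (auto simp: divide_le_eq mult.commute)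
  ultimately show ?thesis by (simp add: divide_le_eq mult.commute)
qed

section \<open>Lower bound on the ratio\<close>

text \<open>Started at its release, job 2 completes at \<open>1 / (1 + b)\<close>, before job 1
  could at \<open>1\<close>. ECTF therefore idles; job 1 then starts at \<open>1 / (1 + b)\<close>
  and completes at \<open>2\<close>, since the two factors \<open>1 + b\<close> cancel the
  square.\<close>

definition waiting_instance :: "real \<Rightarrow> sched_instance" where
  "waiting_instance b = \<lparr>num_jobs = 2,
     release = (\<lambda>i. if i = 2 then 1 / (1 + b)\<^sup>2 else 0),
     fixed_time = (\<lambda>i. if i = 1 then 1 else 0), det_rate = b\<rparr>"

lemma jobs_waiting_instance: "jobs (waiting_instance b) = {1, 2}"
  by (auto simp: jobs_def waiting_instance_def)

lemma valid_waiting_instance: "0 < b \<Longrightarrow> valid_instance (waiting_instance b)"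
  by (auto simp: valid_instance_def waiting_instance_def)

lemma next_completion_waiting_instance:
  assumes "0 < b"
  shows "next_completion (waiting_instance b) 1 0 = 1"
    "next_completion (waiting_instance b) 2 0 = 1 / (1 + b)"
  using assms
  by (simp_all add: next_completion_def waiting_instance_def power2_eq_square max_def)

lemma ectf_waiting_instance:
  assumes "0 < b" "ectf_schedule (waiting_instance b) s"
  shows "2 \<le> makespan (waiting_instance b) s"
proof -
  let ?I = "waiting_instance b"
  have lt: "next_completion ?I 2 0 < next_completion ?I 1 0"
    using assms(1) by (simp add: next_completion_waiting_instance del: One_nat_def)
  from assms(2) have "ectf_run ?I 0 {1, 2} s"
    by (simp add: ectf_schedule_def jobs_waiting_instance)
  then obtain i where "i \<in> {1, 2}" "\<forall>j\<in>{1, 2}. next_completion ?I i 0 \<le> next_completion ?I j 0"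
    "ectf_run ?I (next_completion ?I i 0) ({1, 2} - {i}) s"
    by (cases rule: ectf_run.cases) auto
  moreover from this lt have "i = 2" by force
  moreover have "{1, 2} - {2} = {1 :: nat}" by auto
  ultimately have "ectf_run ?I (1 / (1 + b)) {1} s"
    using next_completion_waiting_instance(2)[OF assms(1)] by simp
  then have "s 1 = max (1 / (1 + b)) (release ?I 1)"
    by (cases rule: ectf_run.cases) auto
  then have "s 1 = 1 / (1 + b)"
    using assms(1) by (simp add: waiting_instance_def max_def)
  then have "completion ?I s 1 = 2"
    using assms(1) by (simp add: completion_eq) (simp add: waiting_instance_def)
  then show ?thesis
    using completion_le_makespan[of 1 ?I s] by (simp add: jobs_waiting_instance)
qed

lemma opt_waiting_instance:
  assumes "0 < b"
  shows "opt_makespan (waiting_instance b) \<le> 1 + b"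
proof -
  let ?I = "waiting_instance b"
  \<comment> \<open>Job 1 runs first; by its completion at \<open>1\<close>, job 2 is already
    released and takes only \<open>b\<close>.\<close>
  define s :: schedule where "s i = (if i = 1 then 0 else 1)" for i
  have c: "completion ?I s 1 = 1" "completion ?I s 2 = 1 + b"
    by (simp_all add: completion_eq s_def) (simp_all add: waiting_instance_def)
  have "1 / (1 + b)\<^sup>2 \<le> 1" using assms by (simp add: divide_le_eq one_le_power)
  then have "feasible ?I s"
    using c unfolding feasible_def jobs_waiting_instance
    by (auto simp: s_def) (auto simp: waiting_instance_def)
  moreover have "makespan ?I s \<le> 1 + b"
    by (rule makespan_le[OF valid_waiting_instance[OF assms]])
       (use c assms in \<open>auto simp: jobs_waiting_instance\<close>)
  ultimately show ?thesis
    using opt_makespan_le[OF valid_waiting_instance[OF assms]] by force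
qed

lemma ectf_ratio_ge_2:
  assumes "ectf_algorithm A" "approximates A {I. valid_instance I} \<rho>"
  shows "2 \<le> \<rho>"
proof -
  have ratio: "2 \<le> \<rho> * (1 + b)" if b: "0 < b" for b
  proof -
    let ?I = "waiting_instance b"
    have v: "valid_instance ?I" by (rule valid_waiting_instance[OF b])
    then have f: "feasible ?I (A ?I)" and m: "makespan ?I (A ?I) \<le> \<rho> * opt_makespan ?I"
      using assms(2) by (auto simp: approximates_def)
    have two: "2 \<le> \<rho> * opt_makespan ?I"
      using ectf_waiting_instance[OF b, of "A ?I"] assms(1) v m by (simp add: ectf_algorithm_def)
    have "0 \<le> opt_makespan ?I"
      by (rule le_opt_makespan[OF f makespan_nonneg[OF v]])
    \<comment> \<open>The sign of \<open>\<rho>\<close> matters: the optimum is about to be replaced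
      by its upper bound \<open>1 + b\<close>.\<close>
    with two have "0 < \<rho>"
      by (smt (verit) mult_nonneg_nonpos2 mult.commute)
    then have "\<rho> * opt_makespan ?I \<le> \<rho> * (1 + b)"
      using opt_waiting_instance[OF b] by simp
    with two show ?thesis by simp
  qed
  \<comment> \<open>A single \<open>b\<close> yields only \<open>2 / (1 + b)\<close>; the constant
    \<open>2\<close> is reached as \<open>b\<close> tends to \<open>0\<close> from the
    right.\<close>
  have "((\<lambda>b. \<rho> * (1 + b)) \<longlongrightarrow> \<rho> * (1 + 0)) (at_right 0)"
    by (intro tendsto_intros)
  moreover have "\<forall>\<^sub>F b in at_right 0. 2 \<le> \<rho> * (1 + b)"
    using ratio by (auto simp: eventually_at_filter)
  ultimately have "2 \<le> \<rho> * (1 + 0)"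
    by (rule tendsto_lowerbound) simp
  then show ?thesis by simp
qed

theorem theorem15:
  fixes A :: "sched_instance \<Rightarrow> schedule"
  assumes "ectf_algorithm A"
  shows "(\<forall>\<beta>>0. approximates A {I. valid_instance I \<and> det_rate I = \<beta>} (3 + 1 / \<beta>)) \<and>
         (\<forall>\<rho>. approximates A {I. valid_instance I} \<rho> \<longrightarrow> 2 \<le> \<rho>)"
proof (intro conjI allI impI)
  fix \<rho> assume "approximates A {I. valid_instance I} \<rho>"
  then show "2 \<le> \<rho>" by (rule ectf_ratio_ge_2[OF assms])
next
  fix \<beta> :: real assume "\<beta> > 0"
  show "approximates A {I. valid_instance I \<and> det_rate I = \<beta>} (3 + 1 / \<beta>)"
    unfolding approximates_def
  proof safe
    fix I assume I: "valid_instance I" "\<beta> = det_rate I"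
    then have E: "ectf_schedule I (A I)" using assms by (simp add: ectf_algorithm_def)
    show F: "feasible I (A I)" by (rule ectf_schedule_feasible[OF I(1) E])
    have "0 \<le> opt_makespan I"
      by (rule le_opt_makespan[OF F makespan_nonneg[OF I(1)]])
    \<comment> \<open>The factor \<open>2 + 1 / det_rate I\<close> may be enlarged by
      \<open>1\<close> because the optimum is nonnegative.\<close>
    then show "makespan I (A I) \<le> (3 + 1 / det_rate I) * opt_makespan I"
      using ectf_makespan_le_opt[OF I(1) E] by (simp add: algebra_simps)
  qed
qed

end
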